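(* Let $1\le k\le M$ and $x>0$. Let $i^*$ be the index of the device with the $k$-th largest uplink channel gain among $|h_1|^2,\dots,|h_M|^2$ (information-based selection, IBS). Then the outage probability $\Pi^{(k)}_{\rm IBS}(x)=\mathbb P\{X_{i^*}\le x\}$ is $$\Pi^{(k)}_{\rm IBS}(x)=1-k\binom Mk\sum_{m=0}^{M-k}(-1)^m\binom{M-k}{m}\Phi(x,m),$$ where $$\Phi(x,m)=\int_r^\infty\exp\left(-(k+m)z-\frac{cr}{P_t(z-r)}\right)dz,\qquad r=\frac{\sigma_n^2ct_2x}{t_1(ac-b)}.$$
   Context: There are $M\ge 1$ devices. The channel gains $|g_1|^2,\dots,|g_M|^2,|h_1|^2,\dots,|h_M|^2$ are independent exponential random variables with mean $1$. Parameters: $P_t>0$, $\sigma_n^2>0$, $0<t_1<1$, $t_2=1-t_1$, and real constants $a,b,c$ with $c>0$ and $ac-b>0$. The energy harvested by device $i$ is $E_i=t_1\left(\frac{aP_t|g_i|^2+b}{P_t|g_i|^2+c}-\frac bc\right)$, and the SNR of device $i$ is $X_i=\frac{|h_i|^2}{t_2\sigma_n^2}E_i$. The outage probability at rate threshold $Q>0$ is $\mathbb P\{t_2\log_2(1+X)\le Q\}=\mathbb P\{X\le x\}$ with $x=2^{Q/t_2}-1$. The $|h_i|^2$ are almost surely distinct, so $i^*$ is almost surely well defined. *)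

theory Defs
  imports "HOL-Probability.Probability"
begin

text \<open>
  Throughout, the real arguments \<open>g\<close> and \<open>h\<close> are the channel gains, i.e. the squared moduli of the
  downlink and uplink channel coefficients, not the coefficients themselves.
\<close>

definition harvested_energy ::
    "real \<Rightarrow> real \<Rightarrow> real \<Rightarrow> real \<Rightarrow> real \<Rightarrow> real \<Rightarrow> real" where
  "harvested_energy t\<^sub>1 P\<^sub>t a b c g = t\<^sub>1 * ((a * P\<^sub>t * g + b) / (P\<^sub>t * g + c) - b / c)"

definition snr ::
    "real \<Rightarrow> real \<Rightarrow> real \<Rightarrow> real \<Rightarrow> real \<Rightarrow> real \<Rightarrow> real \<Rightarrow> real \<Rightarrow> real \<Rightarrow> real" where
  "snr t\<^sub>1 t\<^sub>2 P\<^sub>t \<sigma>\<^sub>n a b c g h = h / (t\<^sub>2 * \<sigma>\<^sub>n\<^sup>2) * harvested_energy t\<^sub>1 P\<^sub>t a b c g"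

text \<open>
  The device among \<open>1, \<dots>, M\<close> whose gain \<open>u i\<close> is the \<open>k\<close>-th largest: the devices are listed by
  decreasing gain and the \<open>k\<close>-th entry is taken (list positions start at 0). Ties are resolved in
  favour of the smaller index, so that the result is a device for every \<open>u\<close>.
\<close>

definition kth_largest_index :: "nat \<Rightarrow> nat \<Rightarrow> (nat \<Rightarrow> real) \<Rightarrow> nat" where
  "kth_largest_index M k u = sort_key (\<lambda>i. - u i) [1..<Suc M] ! (k - 1)"

text \<open>
  When the gains are distinct, this is the unique device that exactly \<open>k - 1\<close> devices beat strictly.
\<close>

lemma kth_largest_index_unique:
  assumes inj: "inj_on u {1..M}" and k: "1 \<le> k" "k \<le> M"
  shows "i \<in> {1..M} \<and> card {j \<in> {1..M}. u i < u j} = k - 1 \<longleftrightarrow> i = kth_largest_index M k u"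
proof -
  define xs where "xs = sort_key (\<lambda>i. - u i) [1..<Suc M]"
  have set_xs: "set xs = {1..M}" and dist: "distinct xs" and len: "length xs = M"
    by (auto simp: xs_def)
  have sorted: "sorted (map (\<lambda>i. - u i) xs)"
    by (simp add: xs_def)
  have less: "u (xs ! q) < u (xs ! p)" if "p < q" "q < M" for p q
  proof -
    have "u (xs ! q) \<le> u (xs ! p)"
      using sorted_nth_mono[OF sorted, of p q] that len by simp
    moreover have "u (xs ! q) \<noteq> u (xs ! p)"
    proof
      assume "u (xs ! q) = u (xs ! p)"
      moreover have "xs ! q \<in> {1..M}" "xs ! p \<in> {1..M}"
        using that len nth_mem[of _ xs] set_xs by auto
      ultimately have "xs ! q = xs ! p"
        using inj by (auto dest: inj_onD)
      then show False
        using dist that len by (simp add: nth_eq_iff_index_eq)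
    qed
    ultimately show ?thesis by simp
  qed
  have card: "card {j \<in> {1..M}. u (xs ! n) < u j} = n" if n: "n < M" for n
  proof -
    have "{j \<in> {1..M}. u (xs ! n) < u j} = (\<lambda>p. xs ! p) ` {..<n}"
    proof (intro set_eqI iffI)
      fix j assume j: "j \<in> {j \<in> {1..M}. u (xs ! n) < u j}"
      then obtain p where p: "p < M" "j = xs ! p"
        using set_xs len by (metis (no_types, lifting) in_set_conv_nth mem_Collect_eq)
      have "p < n"
        using less[of n p] j p by (metis (no_types, lifting) linorder_neqE_nat mem_Collect_eq
            order_less_asym order_less_irrefl)
      then show "j \<in> (\<lambda>p. xs ! p) ` {..<n}"
        using p by auto
    next
      fix j assume "j \<in> (\<lambda>p. xs ! p) ` {..<n}"
      then obtain p where p: "p < n" "j = xs ! p" by auto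
      then have "j \<in> set xs"
        using n len by simp
      then show "j \<in> {j \<in> {1..M}. u (xs ! n) < u j}"
        using less[of p n] n p set_xs by simp
    qed
    moreover have "inj_on (\<lambda>p. xs ! p) {..<n}"
      using dist n len by (auto intro!: inj_on_nth)
    ultimately show ?thesis
      by (simp add: card_image)
  qed
  have idx: "kth_largest_index M k u = xs ! (k - 1)"
    by (simp add: kth_largest_index_def xs_def)
  show ?thesis
  proof
    assume i: "i \<in> {1..M} \<and> card {j \<in> {1..M}. u i < u j} = k - 1"
    then obtain p where p: "p < M" "i = xs ! p"
      using set_xs len by (metis in_set_conv_nth)
    then show "i = kth_largest_index M k u"
      using card[of p] i idx by simp
  next
    assume i: "i = kth_largest_index M k u"
    have "xs ! (k - 1) \<in> set xs"
      using k len by simp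
    then show "i \<in> {1..M} \<and> card {j \<in> {1..M}. u i < u j} = k - 1"
      using card[of "k - 1"] k set_xs unfolding i idx by simp
  qed
qed

text \<open>
  Outage probability of information-based selection: \<open>G i\<close> and \<open>H i\<close> are the downlink and uplink
  gains of device \<open>i\<close>, and the selection is made on the uplink gains only.
\<close>

definition ibs_outage ::
    "'a measure \<Rightarrow> nat \<Rightarrow> (nat \<Rightarrow> 'a \<Rightarrow> real) \<Rightarrow> (nat \<Rightarrow> 'a \<Rightarrow> real) \<Rightarrow>
     real \<Rightarrow> real \<Rightarrow> real \<Rightarrow> real \<Rightarrow> real \<Rightarrow> real \<Rightarrow> real \<Rightarrow> nat \<Rightarrow> real \<Rightarrow> real" where
  "ibs_outage \<Omega> M G H t\<^sub>1 t\<^sub>2 P\<^sub>t \<sigma>\<^sub>n a b c k x =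
     measure \<Omega> {\<omega> \<in> space \<Omega>.
       let i = kth_largest_index M k (\<lambda>j. H j \<omega>)
       in snr t\<^sub>1 t\<^sub>2 P\<^sub>t \<sigma>\<^sub>n a b c (G i \<omega>) (H i \<omega>) \<le> x}"

definition ibs_threshold ::
    "real \<Rightarrow> real \<Rightarrow> real \<Rightarrow> real \<Rightarrow> real \<Rightarrow> real \<Rightarrow> real \<Rightarrow> real" where
  "ibs_threshold t\<^sub>1 t\<^sub>2 \<sigma>\<^sub>n a b c x = \<sigma>\<^sub>n\<^sup>2 * c * t\<^sub>2 * x / (t\<^sub>1 * (a * c - b))"

text \<open>
  The integral is taken over the open half-line because the integrand is singular at \<open>z = r\<close>, where
  division by zero would yield 0.
\<close>

definition ibs_Phi :: "real \<Rightarrow> real \<Rightarrow> nat \<Rightarrow> real \<Rightarrow> nat \<Rightarrow> real" where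
  "ibs_Phi P\<^sub>t c k r m =
     (LBINT z:{r<..}. exp (- real (k + m) * z - c * r / (P\<^sub>t * (z - r))))"

end

theory Submission
  imports Defs
begin

text \<open>
  A device with downlink gain \<open>g > 0\<close> and uplink gain \<open>h\<close> is not in outage iff \<open>h > r\<close> and
  \<open>g > c r / (P\<^sub>t (h - r))\<close>. Almost surely there are no ties, so the event that the selected device
  is not in outage splits according to the selected device \<open>i\<close> and the set \<open>S\<close> of the \<open>k - 1\<close>
  devices with a larger uplink gain. There are \<open>k * (M choose k)\<close> such pairs, and conditioning on
  \<open>H i = z\<close> gives each of them the probability
  \<open>\<integral> exp (- z) * exp (- (k - 1) z) * (1 - exp (- z)) ^ (M - k) * exp (- c r / (P\<^sub>t (z - r))) dz\<close>
  over \<open>z > r\<close>; the binomial theorem turns this into the alternating sum.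
\<close>

section \<open>Measurability of the selected index\<close>

lemma insort_key_cong_order:
  assumes "\<And>p q. p \<in> insert x (set xs) \<Longrightarrow> q \<in> insert x (set xs) \<Longrightarrow> f p \<le> f q \<longleftrightarrow> g p \<le> g q"
  shows "insort_key f x xs = insort_key g x xs"
  using assms by (induction xs) auto

text \<open>Insertion sort uses its keys only through comparisons \<open>\<le>\<close>, so two key
  functions that order the listed elements alike give the same list, ties included.\<close>

lemma sort_key_cong_order:
  assumes "\<And>p q. p \<in> set xs \<Longrightarrow> q \<in> set xs \<Longrightarrow> f p \<le> f q \<longleftrightarrow> g p \<le> g q"
  shows "sort_key f xs = sort_key g xs"
  using assms
proof (induction xs)
  case (Cons x xs)
  have "sort_key f xs = sort_key g xs"
    using Cons by simp
  moreover have "insort_key f x (sort_key g xs) = insort_key g x (sort_key g xs)"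
    by (rule insort_key_cong_order) (use Cons.prems in auto)
  ultimately show ?case
    by simp
qed simp

text \<open>
  The index depends only on which of the inequalities \<open>H p \<omega> \<le> H q \<omega>\<close> hold, so the event is a
  finite union of events determined by these inequalities.
\<close>

lemma measurable_kth_largest_index:
  assumes [measurable]: "\<And>i. i \<in> {1..M} \<Longrightarrow> H i \<in> borel_measurable N"
  shows "{\<omega> \<in> space N. kth_largest_index M k (\<lambda>j. H j \<omega>) = i} \<in> sets N"
proof -
  define R where "R u = {(p, q) \<in> {1..M} \<times> {1..M}. u p \<le> u q}" for u :: "nat \<Rightarrow> real"
  have kth_R: "kth_largest_index M k u = kth_largest_index M k v" if "R u = R v" for u v
  proof -
    have *: "- u p \<le> - u q \<longleftrightarrow> - v p \<le> - v q" if "p \<in> set [1..<Suc M]" "q \<in> set [1..<Suc M]" for p q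
    proof -
      \<comment> \<open>The sort keys are the negated gains, which is why the pair appears
        reversed.\<close>
      have "(q, p) \<in> R u \<longleftrightarrow> (q, p) \<in> R v" using \<open>R u = R v\<close> by simp
      then show ?thesis using that unfolding R_def by auto
    qed
    have "sort_key (\<lambda>p. - u p) [1..<Suc M] = sort_key (\<lambda>p. - v p) [1..<Suc M]"
      by (rule sort_key_cong_order) (rule *)
    then show ?thesis
      by (simp only: kth_largest_index_def)
  qed
  \<comment> \<open>\<open>J\<close> collects the order patterns that lead to the index
    \<open>i\<close>. All of them are subsets of one finite square, so there are finitely
    many.\<close>
  define J where "J = R ` {u. kth_largest_index M k u = i}"
  have "J \<subseteq> Pow ({1..M} \<times> {1..M})"
    by (auto simp: J_def R_def)
  then have "finite J"
    by (rule finite_subset) simp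
  have "{\<omega> \<in> space N. R (\<lambda>j. H j \<omega>) = Q} \<in> sets N" if "Q \<in> J" for Q
  proof -
    have Q: "Q \<subseteq> {1..M} \<times> {1..M}"
      using \<open>J \<subseteq> _\<close> that by auto
    have "{\<omega> \<in> space N. R (\<lambda>j. H j \<omega>) = Q} =
        {\<omega> \<in> space N. \<forall>p\<in>{1..M}. \<forall>q\<in>{1..M}. H p \<omega> \<le> H q \<omega> \<longleftrightarrow> (p, q) \<in> Q}"
    proof -
      have "R u = Q \<longleftrightarrow> (\<forall>p\<in>{1..M}. \<forall>q\<in>{1..M}. u p \<le> u q \<longleftrightarrow> (p, q) \<in> Q)" for u
        unfolding R_def set_eq_iff split_paired_All mem_Collect_eq prod.case mem_Sigma_iff
        using Q by blast
      then show ?thesis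
        by simp
    qed
    also have "\<dots> \<in> sets N"
      by measurable
    finally show ?thesis .
  qed
  moreover have "{\<omega> \<in> space N. kth_largest_index M k (\<lambda>j. H j \<omega>) = i} =
      (\<Union>Q\<in>J. {\<omega> \<in> space N. R (\<lambda>j. H j \<omega>) = Q})"
  proof (intro set_eqI iffI)
    fix \<omega> assume "\<omega> \<in> (\<Union>Q\<in>J. {\<omega> \<in> space N. R (\<lambda>j. H j \<omega>) = Q})"
    then obtain u where "\<omega> \<in> space N" "kth_largest_index M k u = i" "R (\<lambda>j. H j \<omega>) = R u"
      by (auto simp: J_def)
    then show "\<omega> \<in> {\<omega> \<in> space N. kth_largest_index M k (\<lambda>j. H j \<omega>) = i}"
      using kth_R[of "\<lambda>j. H j \<omega>" u] by simp
  qed (auto simp: J_def)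
  ultimately show ?thesis
    using \<open>finite J\<close> by auto
qed

section \<open>Conditioning on one of finitely many independent variables\<close>

text \<open>Independence makes the joint law a product measure, and Tonelli splits off the
  coordinate \<open>i\<close>. Once \<open>X i = z\<close> is fixed, the constraints on the other
  variables form a box, whose product measure is the product of its sides.\<close>

lemma (in prob_space) emeasure_indep_vars_conditional:
  fixes X :: "'i \<Rightarrow> 'a \<Rightarrow> real"
  assumes "finite I" and "i \<in> I"
    and indep: "indep_vars (\<lambda>_. borel) X I"
    and B [measurable]: "\<And>j. j \<in> I - {i} \<Longrightarrow> Measurable.pred (borel \<Otimes>\<^sub>M borel) (\<lambda>p. snd p \<in> B j (fst p))"
  shows "emeasure M {\<omega> \<in> space M. \<forall>j\<in>I - {i}. X j \<omega> \<in> B j (X i \<omega>)} =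
    (\<integral>\<^sup>+ z. (\<Prod>j\<in>I - {i}. emeasure (distr M borel (X j)) (B j z)) \<partial>distr M borel (X i))"
proof -
  have rv [measurable]: "X j \<in> borel_measurable M" if "j \<in> I" for j
    using indep that by (auto simp: indep_vars_def)
  \<comment> \<open>The locale \<open>product_prob_space\<close> asks for a probability measure at
    every index, so a point mass at 0 fills the indices outside \<open>I\<close>.\<close>
  define N where "N j = (if j \<in> I then distr M borel (X j) else return borel 0)" for j
  have N: "N j = distr M borel (X j)" if "j \<in> I" for j
    using that by (simp add: N_def)
  have [simp, measurable_cong]: "sets (N j) = sets borel" for j
    by (simp add: N_def)
  have [simp]: "space (N j) = UNIV" for j
    by (simp add: N_def)
  have "prob_space (N j)" for j
    by (auto simp: N_def intro!: prob_space_distr prob_space_return)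
  then interpret N: product_prob_space N
    by (intro product_prob_spaceI)
  define K where "K = I - {i}"
  have K: "finite K" "i \<notin> K" "insert i K = I" "\<And>j. j \<in> K \<Longrightarrow> j \<in> I"
    using assms(1,2) by (auto simp: K_def)
  have B' [measurable]: "Measurable.pred (borel \<Otimes>\<^sub>M borel) (\<lambda>p. snd p \<in> B j (fst p))" if "j \<in> K" for j
    using B that by (simp add: K_def)
  have joint: "distr M (\<Pi>\<^sub>M j\<in>I. borel) (\<lambda>\<omega>. \<lambda>j\<in>I. X j \<omega>) = (\<Pi>\<^sub>M j\<in>I. N j)"
  proof -
    have "distr M (\<Pi>\<^sub>M j\<in>I. borel) (\<lambda>\<omega>. \<lambda>j\<in>I. X j \<omega>) = (\<Pi>\<^sub>M j\<in>I. distr M borel (X j))"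
      using indep_vars_iff_distr_eq_PiM'[of I X "\<lambda>_. borel"] indep rv \<open>i \<in> I\<close> by auto
    also have "\<dots> = (\<Pi>\<^sub>M j\<in>I. N j)"
      by (intro PiM_cong) (simp_all add: N)
    finally show ?thesis .
  qed
  define A where "A = {f \<in> space (\<Pi>\<^sub>M j\<in>I. borel). \<forall>j\<in>K. f j \<in> B j (f i)}"
  have A [measurable]: "A \<in> sets (\<Pi>\<^sub>M j\<in>I. borel)"
  proof -
    have "Measurable.pred (\<Pi>\<^sub>M j\<in>I. borel) (\<lambda>f. f j \<in> B j (f i))" if "j \<in> K" for j
    proof -
      have "(\<lambda>f. (f i, f j)) \<in> (\<Pi>\<^sub>M j\<in>I. borel) \<rightarrow>\<^sub>M borel \<Otimes>\<^sub>M (borel :: real measure)"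
        using \<open>i \<in> I\<close> K(4)[OF that] by measurable
      from measurable_compose[OF this B'[OF that]] show ?thesis
        by simp
    qed
    then show ?thesis
      unfolding A_def using \<open>finite K\<close> by measurable
  qed
  have A': "A \<in> sets (\<Pi>\<^sub>M j\<in>insert i K. N j)"
  proof -
    have "sets (\<Pi>\<^sub>M j\<in>insert i K. N j) = sets (\<Pi>\<^sub>M j\<in>I. borel)"
      unfolding K(3) by (intro sets_PiM_cong) auto
    with A show ?thesis by simp
  qed
  have rm: "(\<lambda>\<omega>. \<lambda>j\<in>I. X j \<omega>) \<in> M \<rightarrow>\<^sub>M (\<Pi>\<^sub>M j\<in>I. borel)"
    by measurable
  have "{\<omega> \<in> space M. \<forall>j\<in>I - {i}. X j \<omega> \<in> B j (X i \<omega>)} = (\<lambda>\<omega>. \<lambda>j\<in>I. X j \<omega>) -` A \<inter> space M"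
    using \<open>i \<in> I\<close> by (auto simp: A_def K_def space_PiM)
  then have "emeasure M {\<omega> \<in> space M. \<forall>j\<in>I - {i}. X j \<omega> \<in> B j (X i \<omega>)} =
      emeasure (\<Pi>\<^sub>M j\<in>insert i K. N j) A"
    using emeasure_distr[OF rm A] by (simp add: joint K(3))
  also have "\<dots> = (\<integral>\<^sup>+ f. indicator A f \<partial>(\<Pi>\<^sub>M j\<in>insert i K. N j))"
    using A' by simp
  also have "\<dots> = (\<integral>\<^sup>+ z. \<integral>\<^sup>+ f. indicator A (f(i := z)) \<partial>(\<Pi>\<^sub>M j\<in>K. N j) \<partial>N i)"
    using A' K by (intro N.product_nn_integral_insert_rev) auto
  also have "\<dots> = (\<integral>\<^sup>+ z. (\<Prod>j\<in>K. emeasure (N j) (B j z)) \<partial>N i)"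
  proof (intro nn_integral_cong)
    fix z
    have Bz: "B j z \<in> sets (N j)" if "j \<in> K" for j
    proof -
      have "Measurable.pred borel (\<lambda>y. snd (z, y) \<in> B j (fst (z, y)))"
        by (rule measurable_compose[OF _ B'[OF that]]) measurable
      then show ?thesis
        by (simp add: pred_def)
    qed
    have "(\<integral>\<^sup>+ f. indicator A (f(i := z)) \<partial>(\<Pi>\<^sub>M j\<in>K. N j)) =
        (\<integral>\<^sup>+ f. indicator (Pi\<^sub>E K (\<lambda>j. B j z)) f \<partial>(\<Pi>\<^sub>M j\<in>K. N j))"
    proof (intro nn_integral_cong)
      fix f assume f: "f \<in> space (\<Pi>\<^sub>M j\<in>K. N j)"
      \<comment> \<open>For fixed \<open>z\<close>, the section of \<open>A\<close> is exactly the
        box with sides \<open>B j z\<close>.\<close>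
      have "f(i := z) \<in> extensional I"
        using f K by (auto simp: space_PiM PiE_def extensional_def)
      then have "f(i := z) \<in> A \<longleftrightarrow> f \<in> Pi\<^sub>E K (\<lambda>j. B j z)"
        using f K by (auto simp: A_def space_PiM PiE_def Pi_def)
      then show "indicator A (f(i := z)) = (indicator (Pi\<^sub>E K (\<lambda>j. B j z)) f :: ennreal)"
        by (auto simp: indicator_def)
    qed
    also have "\<dots> = emeasure (\<Pi>\<^sub>M j\<in>K. N j) (Pi\<^sub>E K (\<lambda>j. B j z))"
      using Bz K by (intro nn_integral_indicator sets_PiM_I_finite) auto
    also have "\<dots> = (\<Prod>j\<in>K. emeasure (N j) (B j z))"
      using Bz K by (intro N.emeasure_PiM) auto
    finally show "(\<integral>\<^sup>+ f. indicator A (f(i := z)) \<partial>(\<Pi>\<^sub>M j\<in>K. N j)) =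
        (\<Prod>j\<in>K. emeasure (N j) (B j z))" .
  qed
  also have "\<dots> = (\<integral>\<^sup>+ z. (\<Prod>j\<in>K. emeasure (distr M borel (X j)) (B j z)) \<partial>distr M borel (X i))"
    using K \<open>i \<in> I\<close> by (simp add: N)
  finally show ?thesis
    by (simp add: K_def)
qed

section \<open>The outage condition of a single device\<close>

text \<open>With \<open>s = P\<^sub>t * g\<close>, the harvested energy is
  \<open>t\<^sub>1 * s * (a * c - b) / (c * (s + c))\<close>. Clearing denominators turns the outage
  condition into \<open>(h - r) * s \<le> c * r\<close>. This always holds for
  \<open>h \<le> r\<close>, and for \<open>r < h\<close> it can be solved for
  \<open>g\<close>.\<close>

lemma snr_le_iff:
  assumes "P\<^sub>t > 0" "\<sigma>\<^sub>n\<^sup>2 > 0" "0 < t\<^sub>1" "0 < t\<^sub>2" "c > 0" "a * c - b > 0" "x > 0" "g > 0"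
    and r: "r = ibs_threshold t\<^sub>1 t\<^sub>2 \<sigma>\<^sub>n a b c x"
  shows "snr t\<^sub>1 t\<^sub>2 P\<^sub>t \<sigma>\<^sub>n a b c g h \<le> x \<longleftrightarrow> \<not> (r < h \<and> c * r / (P\<^sub>t * (h - r)) < g)"
proof -
  define s where "s = P\<^sub>t * g"
  have s: "s > 0" using assms by (simp add: s_def)
  \<comment> \<open>The SNR equals \<open>h * w * s / D\<close>. The threshold \<open>r\<close> is
    scaled so that \<open>x * D = w * (r * (s + c))\<close>, and the positive factor
    \<open>w\<close> cancels.\<close>
  define D where "D = c * (s + c) * t\<^sub>2 * \<sigma>\<^sub>n\<^sup>2"
  have D: "D > 0" using assms s by (simp add: D_def)
  define w where "w = t\<^sub>1 * (a * c - b)"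
  have w: "w > 0" using assms by (simp add: w_def)
  have r_eq: "w * r = \<sigma>\<^sub>n\<^sup>2 * c * t\<^sub>2 * x"
    using w unfolding r ibs_threshold_def w_def[symmetric] by simp
  have "r > 0"
    unfolding r ibs_threshold_def using assms by simp
  have frac: "(a * s + b) / (s + c) - b / c = s * (a * c - b) / (c * (s + c))"
    using s \<open>c > 0\<close> by (simp add: divide_simps) (simp add: algebra_simps)
  have "snr t\<^sub>1 t\<^sub>2 P\<^sub>t \<sigma>\<^sub>n a b c g h = h * w * s / D"
    unfolding snr_def harvested_energy_def
    using frac by (simp add: s_def D_def w_def mult_ac)
  then have "snr t\<^sub>1 t\<^sub>2 P\<^sub>t \<sigma>\<^sub>n a b c g h \<le> x \<longleftrightarrow> h * w * s \<le> x * D"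
    using D by (simp add: pos_divide_le_eq)
  also have "x * D = w * (r * (s + c))"
    using r_eq by (simp add: D_def mult_ac)
  also have "h * w * s \<le> w * (r * (s + c)) \<longleftrightarrow> w * (h * s) \<le> w * (r * (s + c))"
    by (simp add: mult_ac)
  also have "\<dots> \<longleftrightarrow> h * s \<le> r * (s + c)"
    using w by (rule mult_le_cancel_left_pos)
  also have "\<dots> \<longleftrightarrow> (h - r) * s \<le> c * r"
    by (simp add: algebra_simps)
  also have "\<dots> \<longleftrightarrow> \<not> (r < h \<and> c * r / (P\<^sub>t * (h - r)) < g)"
  proof (cases "r < h")
    case True
    then show ?thesis
      using \<open>P\<^sub>t > 0\<close> by (simp add: s_def pos_divide_less_eq not_less mult_ac)
  next
    case False
    then have "(h - r) * s \<le> 0"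
      using s by (simp add: mult_nonpos_nonneg)
    also have "0 \<le> c * r"
      using \<open>c > 0\<close> \<open>r > 0\<close> by simp
    finally show ?thesis
      using False by simp
  qed
  finally show ?thesis .
qed


section \<open>Probability of one rank pattern without outage\<close>

text \<open>Condition on \<open>H i = z\<close> with \<open>r < z\<close>. Then \<open>G i\<close>
  exceeds \<open>\<tau> z\<close> with probability \<open>exp (- \<tau> z)\<close>, each device in
  \<open>S\<close> lies above \<open>z\<close> with probability \<open>exp (- z)\<close>, and each
  remaining one does not with probability \<open>1 - exp (- z)\<close>. The density of
  \<open>H i\<close> supplies one more factor \<open>exp (- z)\<close>, hence
  \<open>Suc (card S)\<close>.\<close>

lemma (in prob_space) prob_rank_and_threshold:
  fixes G H :: "'i \<Rightarrow> 'a \<Rightarrow> real" and \<tau> :: "real \<Rightarrow> real"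
  assumes "finite A" and "i \<in> A" and "S \<subseteq> A - {i}"
    and indep: "indep_vars (\<lambda>_. borel) (case_sum G H) (A <+> A)"
    and G: "distributed M lborel (G i) (exponential_density 1)"
    and H: "\<And>j. j \<in> A \<Longrightarrow> distributed M lborel (H j) (exponential_density 1)"
    and \<tau> [measurable]: "\<tau> \<in> borel_measurable borel"
    and \<tau>_nonneg: "\<And>z. r < z \<Longrightarrow> 0 \<le> \<tau> z"
    and r: "0 \<le> r"
  shows "prob {\<omega> \<in> space M. r < H i \<omega> \<and> \<tau> (H i \<omega>) < G i \<omega> \<and>
      (\<forall>j\<in>A - {i}. if j \<in> S then H i \<omega> < H j \<omega> else H j \<omega> \<le> H i \<omega>)} =
    (LBINT z:{r<..}. exp (- real (Suc (card S)) * z - \<tau> z) * (1 - exp (- z)) ^ (card A - Suc (card S)))"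
    (is "prob ?E = _")
proof -
  \<comment> \<open>Only one downlink gain, that of \<open>i\<close>, enters the event, together
    with all uplink gains; \<open>K\<close> omits the conditioning variable
    \<open>H i\<close>.\<close>
  define I where "I = insert (Inl i) (Inr ` A)"
  define K where "K = I - {Inr i}"
  have K: "K = insert (Inl i) (Inr ` (A - {i}))"
    by (auto simp: K_def I_def)
  define X where "X = case_sum G H"
  \<comment> \<open>The condition \<open>r < z\<close> concerns the conditioning variable alone.
    Placed in the constraint on \<open>G i\<close>, it makes the whole product vanish for
    \<open>z \<le> r\<close>.\<close>
  define B where "B l z = (case l of Inl _ \<Rightarrow> {g. r < z \<and> \<tau> z < g} | Inr j \<Rightarrow> if j \<in> S then {z<..} else {..z})"
    for l :: "'i + 'i" and z :: real
  have indep_I: "indep_vars (\<lambda>_. borel) X I"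
    unfolding X_def by (rule indep_vars_subset[OF indep]) (use \<open>i \<in> A\<close> in \<open>auto simp: I_def\<close>)
  have X: "distributed M lborel (X l) (exponential_density 1)" if "l \<in> I" for l
    using that G H by (auto simp: I_def X_def)
  have X_meas [measurable]: "X l \<in> borel_measurable M" if "l \<in> I" for l
    using distributed_measurable[OF X[OF that]] by simp
  have gt: "emeasure (distr M borel (X l)) {u<..} = ennreal (exp (- u))" if "l \<in> I" "0 \<le> u" for l u
    using exponential_distributedD_gt[OF X[OF that(1)] that(2)] X_meas[OF that(1)]
    by (simp add: emeasure_distr emeasure_eq_measure vimage_def Int_def conj_commute)
  have le: "emeasure (distr M borel (X l)) {..u} = ennreal (1 - exp (- u))" if "l \<in> I" "0 \<le> u" for l u
    using exponential_distributedD_le[OF X[OF that(1)] that(2)] X_meas[OF that(1)]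
    by (simp add: emeasure_distr emeasure_eq_measure vimage_def Int_def conj_commute)
  define q where "q z = exp (- \<tau> z) * (exp (- z) ^ card S * (1 - exp (- z)) ^ (card A - Suc (card S)))" for z
  have B_prod: "(\<Prod>l\<in>K. emeasure (distr M borel (X l)) (B l z)) = indicator {r<..} z * ennreal (q z)" for z
  proof (cases "r < z")
    case True
    then have z: "0 \<le> z" using r by simp
    have Inl_i: "emeasure (distr M borel (X (Inl i))) (B (Inl i) z) = ennreal (exp (- \<tau> z))"
      using gt[of "Inl i" "\<tau> z"] True \<tau>_nonneg by (simp add: B_def I_def greaterThan_def)
    have "(\<Prod>j\<in>A - {i}. emeasure (distr M borel (X (Inr j))) (B (Inr j) z)) =
        (\<Prod>j\<in>A - {i}. ennreal (if j \<in> S then exp (- z) else 1 - exp (- z)))"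
      using gt[OF _ z] le[OF _ z] by (intro prod.cong) (auto simp: B_def I_def)
    also have "\<dots> = ennreal (\<Prod>j\<in>A - {i}. if j \<in> S then exp (- z) else 1 - exp (- z))"
      using z by (intro prod_ennreal) auto
    also have "(\<Prod>j\<in>A - {i}. if j \<in> S then exp (- z) else 1 - exp (- z)) =
        exp (- z) ^ card S * (1 - exp (- z)) ^ card (A - {i} - S)"
    proof -
      have "(A - {i}) \<inter> {j. j \<in> S} = S" "(A - {i}) \<inter> - {j. j \<in> S} = A - {i} - S"
        using assms(3) by auto
      then show ?thesis
        using \<open>finite A\<close> by (simp add: prod.If_cases)
    qed
    also have "card (A - {i} - S) = card A - Suc (card S)"
      using assms(1-3) finite_subset[OF assms(3)] by (simp add: card_Diff_subset)
    finally have "(\<Prod>j\<in>A - {i}. emeasure (distr M borel (X (Inr j))) (B (Inr j) z)) =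
        ennreal (exp (- z) ^ card S * (1 - exp (- z)) ^ (card A - Suc (card S)))" .
    moreover have "(\<Prod>l\<in>K. emeasure (distr M borel (X l)) (B l z)) =
        emeasure (distr M borel (X (Inl i))) (B (Inl i) z) *
        (\<Prod>j\<in>A - {i}. emeasure (distr M borel (X (Inr j))) (B (Inr j) z))"
      unfolding K using \<open>finite A\<close> by (subst prod.insert) (auto simp: prod.reindex)
    ultimately show ?thesis
      using True z by (simp add: Inl_i q_def ennreal_mult)
  next
    case False
    then have "emeasure (distr M borel (X (Inl i))) (B (Inl i) z) = 0"
      by (simp add: B_def)
    then show ?thesis
      using False \<open>finite A\<close> unfolding K by (subst prod.insert) auto
  qed
  have B_meas: "Measurable.pred (borel \<Otimes>\<^sub>M borel) (\<lambda>p. snd p \<in> B l (fst p))" for l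
    by (cases l) (auto simp: B_def)
  have [measurable]: "q \<in> borel_measurable borel"
    unfolding q_def by measurable
  have "?E = {\<omega> \<in> space M. \<forall>l\<in>I - {Inr i}. X l \<omega> \<in> B l (X (Inr i) \<omega>)}"
    unfolding K_def[symmetric] K by (auto simp: X_def B_def split: if_splits)
  then have "emeasure M ?E = emeasure M {\<omega> \<in> space M. \<forall>l\<in>I - {Inr i}. X l \<omega> \<in> B l (X (Inr i) \<omega>)}"
    by (rule arg_cong)
  also have "\<dots> = (\<integral>\<^sup>+ z. (\<Prod>l\<in>I - {Inr i}. emeasure (distr M borel (X l)) (B l z)) \<partial>distr M borel (X (Inr i)))"
    using \<open>finite A\<close> \<open>i \<in> A\<close> indep_I B_meas by (intro emeasure_indep_vars_conditional) (auto simp: I_def)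
  also have "\<dots> = (\<integral>\<^sup>+ z. indicator {r<..} z * ennreal (q z) \<partial>distr M lborel (X (Inr i)))"
    unfolding K_def[symmetric] B_prod by (intro nn_integral_cong_simp arg_cong2[where f = nn_integral] distr_cong) auto
  also have "\<dots> = (\<integral>\<^sup>+ z. ennreal (exponential_density 1 z) * (indicator {r<..} z * ennreal (q z)) \<partial>lborel)"
    using \<open>i \<in> A\<close> distributed_distr_eq_density[OF X[of "Inr i"]]
    by (simp add: I_def nn_integral_density)
  \<comment> \<open>Since \<open>0 \<le> r\<close>, the half-line lies where the exponential density
    is \<open>exp (- z)\<close>.\<close>
  also have "\<dots> = (\<integral>\<^sup>+ z. ennreal (indicator {r<..} z *\<^sub>R (exp (- z) * q z)) \<partial>lborel)"
    using r by (intro nn_integral_cong)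
      (auto simp: exponential_density_def ennreal_mult' split: split_indicator)
  finally have E: "emeasure M ?E = (\<integral>\<^sup>+ z. ennreal (indicator {r<..} z *\<^sub>R (exp (- z) * q z)) \<partial>lborel)" .
  \<comment> \<open>The integrand is nonnegative on the half-line, so its real integral is read off
    from the nonnegative integral in \<open>E\<close>.\<close>
  have "(LBINT z:{r<..}. exp (- z) * q z) = enn2real (emeasure M ?E)"
    unfolding set_lebesgue_integral_def E using r
    by (intro integral_eq_nn_integral) (auto simp: q_def split: split_indicator)
  then have "prob ?E = (LBINT z:{r<..}. exp (- z) * q z)"
    by (simp add: measure_def)
  also have "\<dots> = (LBINT z:{r<..}. exp (- real (Suc (card S)) * z - \<tau> z) * (1 - exp (- z)) ^ (card A - Suc (card S)))"
    by (intro set_lebesgue_integral_cong)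
       (auto simp: q_def exp_of_nat_mult[symmetric] exp_add[symmetric] mult.assoc[symmetric] algebra_simps)
  finally show ?thesis .
qed

section \<open>Absence of ties\<close>

text \<open>Given \<open>H i = z\<close>, an independent \<open>H j\<close> with a density hits
  \<open>z\<close> with probability 0, and there are only finitely many pairs.\<close>

lemma (in prob_space) AE_inj_on_exponential:
  fixes H :: "'i \<Rightarrow> 'a \<Rightarrow> real"
  assumes "finite A" and indep: "indep_vars (\<lambda>_. borel) H A"
    and H: "\<And>j. j \<in> A \<Longrightarrow> distributed M lborel (H j) (exponential_density 1)"
  shows "AE \<omega> in M. inj_on (\<lambda>j. H j \<omega>) A"
proof -
  have meas [measurable]: "H j \<in> borel_measurable M" if "j \<in> A" for j
    using distributed_measurable[OF H[OF that]] by simp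
  have "AE \<omega> in M. H j \<omega> \<noteq> H i \<omega>" if ij: "i \<in> A" "j \<in> A" "i \<noteq> j" for i j
  proof -
    have Diff: "{i, j} - {i} = {j}"
      using ij by auto
    have "emeasure M {\<omega> \<in> space M. \<forall>l\<in>{i, j} - {i}. H l \<omega> \<in> {H i \<omega>}} =
        (\<integral>\<^sup>+ z. (\<Prod>l\<in>{i, j} - {i}. emeasure (distr M borel (H l)) {z}) \<partial>distr M borel (H i))"
      using ij by (intro emeasure_indep_vars_conditional[where B = "\<lambda>_ z. {z}"])
        (auto intro: indep_vars_subset[OF indep])
    also have "\<dots> = 0"
    proof -
      have "distr M borel (H j) = distr M lborel (H j)"
        by (intro distr_cong) auto
      then have "distr M borel (H j) = density lborel (exponential_density 1)"
        using distributed_distr_eq_density[OF H[OF ij(2)]] by simp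
      then have "emeasure (distr M borel (H j)) {z} = 0" for z
        by (simp add: emeasure_density nn_integral_null_set)
      then show ?thesis
        by (simp add: Diff)
    qed
    finally have "emeasure M {\<omega> \<in> space M. H j \<omega> = H i \<omega>} = 0"
      by (simp add: Diff)
    then show ?thesis
      using ij by (intro AE_I[where N = "{\<omega> \<in> space M. H j \<omega> = H i \<omega>}"]) auto
  qed
  then have "AE \<omega> in M. \<forall>i\<in>A. \<forall>j\<in>A. i \<noteq> j \<longrightarrow> H j \<omega> \<noteq> H i \<omega>"
    using \<open>finite A\<close> by (simp add: AE_finite_all AE_all_countable[symmetric] del: AE_all_countable)
  then show ?thesis
    by eventually_elim (auto simp: inj_on_def)
qed

section \<open>Binomial expansion of the integral\<close>

text \<open>On the half-line \<open>z\<close> is nonnegative, so for \<open>n \<ge> 1\<close> the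
  integrand is dominated by \<open>exp (- z)\<close>. This justifies the termwise integration of the
  binomial sum.\<close>

lemma set_integrable_ibs_Phi:
  fixes P\<^sub>t c r :: real
  assumes "0 \<le> c" "0 \<le> r" "0 \<le> P\<^sub>t" "1 \<le> n"
  shows "set_integrable lborel {r<..} (\<lambda>z. exp (- real n * z - c * r / (P\<^sub>t * (z - r))))"
proof (rule set_integrable_bound)
  have "set_integrable lborel {0<..} (\<lambda>z::real. exp (- z))"
    using has_bochner_integral_I0i_power_exp_m[of 0]
    by (simp add: set_integrable_def has_bochner_integral_iff mult.commute)
  then show "set_integrable lborel {r<..} (\<lambda>z::real. exp (- z))"
    by (rule set_integrable_subset) (use assms in auto)
  show "AE z in lborel. z \<in> {r<..} \<longrightarrow>
      norm (exp (- real n * z - c * r / (P\<^sub>t * (z - r)))) \<le> norm (exp (- z))"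
  proof (intro AE_I2 impI)
    fix z assume z: "z \<in> {r<..}"
    have "1 * z \<le> real n * z"
      using z assms by (intro mult_right_mono) auto
    moreover have "0 \<le> c * r / (P\<^sub>t * (z - r))"
      using z assms by simp
    ultimately show "norm (exp (- real n * z - c * r / (P\<^sub>t * (z - r)))) \<le> norm (exp (- z))"
      by simp
  qed
qed (simp add: set_borel_measurable_def)

text \<open>In the expansion of \<open>(1 - exp (- z)) ^ n\<close>, the power
  \<open>exp (- z) ^ m\<close> raises the rate from \<open>k\<close> to \<open>k + m\<close>, which
  gives the integrand of \<open>ibs_Phi\<close>.\<close>

lemma integral_binomial_ibs_Phi:
  fixes P\<^sub>t c r :: real
  assumes "0 \<le> c" "0 \<le> r" "0 \<le> P\<^sub>t" "1 \<le> k"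
  shows "(LBINT z:{r<..}. exp (- real k * z - c * r / (P\<^sub>t * (z - r))) * (1 - exp (- z)) ^ n) =
    (\<Sum>m = 0..n. (- 1) ^ m * real (n choose m) * ibs_Phi P\<^sub>t c k r m)"
proof -
  have *: "exp (- real k * z - c * r / (P\<^sub>t * (z - r))) * (1 - exp (- z)) ^ n =
     (\<Sum>m = 0..n. (- 1) ^ m * real (n choose m) * exp (- real (k + m) * z - c * r / (P\<^sub>t * (z - r))))" for z
  proof -
    \<comment> \<open>This order of the summands lets \<open>binomial_ring\<close> attach the index
      \<open>m\<close> to the powers of \<open>- exp (- z)\<close>.\<close>
    have "(1 - exp (- z)) ^ n = (- exp (- z) + 1) ^ n"
      by simp
    also have "\<dots> = (\<Sum>m\<le>n. real (n choose m) * (- exp (- z)) ^ m * 1 ^ (n - m))"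
      by (rule binomial_ring)
    also have "\<dots> = (\<Sum>m = 0..n. (- 1) ^ m * real (n choose m) * exp (- real m * z))"
      by (intro sum.cong) (auto simp: power_minus[of "exp _"] exp_of_nat_mult[symmetric])
    finally have "exp (- real k * z - c * r / (P\<^sub>t * (z - r))) * (1 - exp (- z)) ^ n =
        (\<Sum>m = 0..n. (- 1) ^ m * real (n choose m) *
          (exp (- real k * z - c * r / (P\<^sub>t * (z - r))) * exp (- real m * z)))"
      by (simp add: sum_distrib_left mult_ac)
    moreover have "exp (- real k * z - c * r / (P\<^sub>t * (z - r))) * exp (- real m * z) =
        exp (- real (k + m) * z - c * r / (P\<^sub>t * (z - r)))" for m
      unfolding exp_add[symmetric] by (rule arg_cong[where f = exp]) (simp add: algebra_simps)
    ultimately show ?thesis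
      by simp
  qed
  have int: "set_integrable lborel {r<..} (\<lambda>z. (- 1) ^ m * real (n choose m) *
      exp (- real (k + m) * z - c * r / (P\<^sub>t * (z - r))))" for m
    using set_integrable_ibs_Phi[OF assms(1-3), of "k + m"] assms(4)
    by (intro set_integrable_mult_right) simp
  have "(LBINT z:{r<..}. exp (- real k * z - c * r / (P\<^sub>t * (z - r))) * (1 - exp (- z)) ^ n) =
      (\<Sum>m = 0..n. LBINT z:{r<..}. (- 1) ^ m * real (n choose m) *
        exp (- real (k + m) * z - c * r / (P\<^sub>t * (z - r))))"
    unfolding * set_lebesgue_integral_def scaleR_sum_right
    by (rule Bochner_Integration.integral_sum) (rule int[unfolded set_integrable_def])
  then show ?thesis
    by (simp only: ibs_Phi_def set_integral_mult_right)
qed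

theorem theorem4:
  fixes \<Omega> :: "'a measure"
    and G H :: "nat \<Rightarrow> 'a \<Rightarrow> real"
    and M k :: nat
    and P\<^sub>t \<sigma>\<^sub>n t\<^sub>1 t\<^sub>2 a b c x r :: real
  assumes "prob_space \<Omega>"
    and "M \<ge> 1"
    and "prob_space.indep_vars \<Omega> (\<lambda>_. borel) (case_sum G H) ({1..M} <+> {1..M})"
    and "\<And>i. i \<in> {1..M} \<Longrightarrow> distributed \<Omega> lborel (G i) (exponential_density 1)"
    and "\<And>i. i \<in> {1..M} \<Longrightarrow> distributed \<Omega> lborel (H i) (exponential_density 1)"
    and "P\<^sub>t > 0" and "\<sigma>\<^sub>n\<^sup>2 > 0"
    and "0 < t\<^sub>1" and "t\<^sub>1 < 1" and "t\<^sub>2 = 1 - t\<^sub>1"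
    and "c > 0" and "a * c - b > 0"
    and "1 \<le> k" and "k \<le> M" and "x > 0"
    and "r = ibs_threshold t\<^sub>1 t\<^sub>2 \<sigma>\<^sub>n a b c x"
  shows "ibs_outage \<Omega> M G H t\<^sub>1 t\<^sub>2 P\<^sub>t \<sigma>\<^sub>n a b c k x =
    1 - real k * real (M choose k) *
      (\<Sum>m = 0..M - k. (- 1) ^ m * real ((M - k) choose m) * ibs_Phi P\<^sub>t c k r m)"
proof -
  interpret prob_space \<Omega> by fact
  have t2: "t\<^sub>2 > 0"
    using assms(9,10) by simp
  have r: "r > 0"
    unfolding assms(16) ibs_threshold_def using assms(7,8,11,12,15) t2
    by (intro divide_pos_pos mult_pos_pos)
  note indep = assms(3) and G = assms(4) and H = assms(5)
  have G_meas [measurable]: "G i \<in> borel_measurable \<Omega>" if "i \<in> {1..M}" for i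
    using distributed_measurable[OF G[OF that]] by simp
  have H_meas [measurable]: "H i \<in> borel_measurable \<Omega>" if "i \<in> {1..M}" for i
    using distributed_measurable[OF H[OF that]] by simp

  \<comment> \<open>Rank events and their number\<close>
  define \<tau> where "\<tau> z = c * r / (P\<^sub>t * (z - r))" for z
  have [measurable]: "\<tau> \<in> borel_measurable borel"
    unfolding \<tau>_def by measurable
  \<comment> \<open>\<open>E (i, S)\<close>: device \<open>i\<close> is not in outage, and
    \<open>S\<close> is exactly the set of devices with a larger uplink gain.\<close>
  define E where "E = (\<lambda>(i, S). {\<omega> \<in> space \<Omega>. r < H i \<omega> \<and> \<tau> (H i \<omega>) < G i \<omega> \<and>
      (\<forall>j\<in>{1..M} - {i}. if j \<in> S then H i \<omega> < H j \<omega> else H j \<omega> \<le> H i \<omega>)})"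
  define D where "D = (SIGMA i:{1..M}. {S. S \<subseteq> {1..M} - {i} \<and> card S = k - 1})"
  have fin_D: "finite D"
    unfolding D_def by (intro finite_SigmaI) auto
  have card_D: "card D = k * (M choose k)"
  proof -
    \<comment> \<open>There are \<open>M\<close> choices of the device and then
      \<open>(M - 1) choose (k - 1)\<close> sets ahead of it; the absorption identity rewrites the
      product.\<close>
    have "card D = M * ((M - 1) choose (k - 1))"
      unfolding D_def by (subst card_SigmaI) (auto simp: n_subsets card_Diff_singleton)
    also have "\<dots> = k * (M choose k)"
      using times_binomial_minus1_eq[of k M] assms(13) by simp
    finally show ?thesis .
  qed
  have E_meas: "E d \<in> sets \<Omega>" if "d \<in> D" for d
  proof -
    obtain i S where d: "d = (i, S)" by fastforce
    then have [measurable]: "i \<in> {1..M}" using that by (auto simp: D_def)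
    have "Measurable.pred \<Omega> (\<lambda>\<omega>. if j \<in> S then H i \<omega> < H j \<omega> else H j \<omega> \<le> H i \<omega>)" if "j \<in> {1..M} - {i}" for j
      using that by (cases "j \<in> S") auto
    then show ?thesis
      unfolding E_def d prod.case by measurable
  qed

  \<comment> \<open>Almost sure properties of the gains\<close>
  have inj: "AE \<omega> in \<Omega>. inj_on (\<lambda>j. H j \<omega>) {1..M}"
  proof -
    \<comment> \<open>Independence is given for the family on the disjoint sum, so ties are excluded
      on its \<open>Inr\<close> part first and the result is carried back along
      \<open>Inr\<close>.\<close>
    have "AE \<omega> in \<Omega>. inj_on (\<lambda>l. case_sum G H l \<omega>) (Inr ` {1..M})"
    proof (rule AE_inj_on_exponential)
      show "indep_vars (\<lambda>_. borel) (case_sum G H) (Inr ` {1..M})"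
        by (rule indep_vars_subset[OF indep]) auto
    qed (use H in auto)
    then show ?thesis
    proof eventually_elim
      case (elim \<omega>)
      from comp_inj_on[OF inj_Inr elim] show ?case
        by (simp add: comp_def)
    qed
  qed
  \<comment> \<open>Positive downlink gains are what \<open>snr_le_iff\<close> requires.\<close>
  have pos: "AE \<omega> in \<Omega>. 0 < G i \<omega>" if "i \<in> {1..M}" for i
  proof (rule AE_I_eq_1)
    show "emeasure \<Omega> {\<omega> \<in> space \<Omega>. 0 < G i \<omega>} = 1"
      using exponential_distributedD_gt[OF G[OF that], of 0] by (simp add: emeasure_eq_measure)
    show "{\<omega> \<in> space \<Omega>. 0 < G i \<omega>} \<in> sets \<Omega>"
      using that by measurable
  qed

  \<comment> \<open>Measurability of the outage event\<close>
  define idx where "idx \<omega> = kth_largest_index M k (\<lambda>j. H j \<omega>)" for \<omega>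
  \<comment> \<open>This holds even when gains tie, so \<open>out\<close> splits over the finitely
    many values of \<open>idx\<close>.\<close>
  have idx_in: "idx \<omega> \<in> {1..M}" for \<omega>
  proof -
    have "sort_key (\<lambda>i. - H i \<omega>) [1..<Suc M] ! (k - 1) \<in> set (sort_key (\<lambda>i. - H i \<omega>) [1..<Suc M])"
      using assms(13,14) by (intro nth_mem) simp
    then show ?thesis
      by (simp add: idx_def kth_largest_index_def less_Suc_eq_le del: upt_Suc)
  qed
  define out where "out = {\<omega> \<in> space \<Omega>. snr t\<^sub>1 t\<^sub>2 P\<^sub>t \<sigma>\<^sub>n a b c (G (idx \<omega>) \<omega>) (H (idx \<omega>) \<omega>) \<le> x}"
  have out_meas: "out \<in> sets \<Omega>"
  proof -
    have "out = (\<Union>i\<in>{1..M}. {\<omega> \<in> space \<Omega>. idx \<omega> = i} \<inter>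
        {\<omega> \<in> space \<Omega>. snr t\<^sub>1 t\<^sub>2 P\<^sub>t \<sigma>\<^sub>n a b c (G i \<omega>) (H i \<omega>) \<le> x})"
      using idx_in by (auto simp: out_def)
    also have "\<dots> \<in> sets \<Omega>"
    proof (intro sets.finite_UN sets.Int)
      show "{\<omega> \<in> space \<Omega>. idx \<omega> = i} \<in> sets \<Omega>" for i
        unfolding idx_def by (rule measurable_kth_largest_index) (rule H_meas)
      show "{\<omega> \<in> space \<Omega>. snr t\<^sub>1 t\<^sub>2 P\<^sub>t \<sigma>\<^sub>n a b c (G i \<omega>) (H i \<omega>) \<le> x} \<in> sets \<Omega>"
        if [measurable]: "i \<in> {1..M}" for i
        unfolding snr_def harvested_energy_def by measurable
    qed simp
    finally show ?thesis .
  qed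

  \<comment> \<open>Disjoint decomposition of the non-outage event\<close>
  \<comment> \<open>Without ties, the outcome determines the pair: \<open>S\<close> must be the set
    of devices ahead of \<open>i\<close>, and its cardinality \<open>k - 1\<close> forces
    \<open>i\<close> to be the selected device.\<close>
  have E_iff: "\<omega> \<in> E (i, S) \<longleftrightarrow> i = idx \<omega> \<and> S = {j \<in> {1..M}. H i \<omega> < H j \<omega>} \<and> r < H i \<omega> \<and> \<tau> (H i \<omega>) < G i \<omega>"
    if "(i, S) \<in> D" "\<omega> \<in> space \<Omega>" "inj_on (\<lambda>j. H j \<omega>) {1..M}" for \<omega> i S
  proof -
    have i: "i \<in> {1..M}" and S: "S \<subseteq> {1..M} - {i}" "card S = k - 1"
      using that(1) by (auto simp: D_def)
    have rank: "(\<forall>j\<in>{1..M} - {i}. if j \<in> S then H i \<omega> < H j \<omega> else H j \<omega> \<le> H i \<omega>) \<longleftrightarrow>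
        S = {j \<in> {1..M}. H i \<omega> < H j \<omega>}"
      (is "?L \<longleftrightarrow> ?R")
    proof
      assume L: ?L
      show ?R
      proof (intro set_eqI iffI)
        fix j assume j: "j \<in> S"
        then have "j \<in> {1..M} - {i}"
          using S(1) by blast
        from bspec[OF L this] this j show "j \<in> {j \<in> {1..M}. H i \<omega> < H j \<omega>}"
          by simp
      next
        fix j assume j: "j \<in> {j \<in> {1..M}. H i \<omega> < H j \<omega>}"
        then have "j \<in> {1..M} - {i}"
          by auto
        from bspec[OF L this] j show "j \<in> S"
          by (simp split: if_splits)
      qed
    next
      assume R: ?R
      show ?L
        unfolding R by (simp add: not_less)
    qed
    have "i = idx \<omega>" if "S = {j \<in> {1..M}. H i \<omega> < H j \<omega>}"
      unfolding idx_def
      by (rule iffD1[OF kth_largest_index_unique[OF \<open>inj_on _ _\<close> assms(13,14)]])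
         (use i S(2) in \<open>simp only: that simp_thms\<close>)
    then show ?thesis
      unfolding E_def prod.case mem_Collect_eq rank using that(2) by blast
  qed
  \<comment> \<open>With ties, several of the events \<open>E d\<close> can occur at once. Removing
    the null set of ties makes the family disjoint everywhere, as finite additivity demands.\<close>
  define E' where "E' d = E d \<inter> {\<omega> \<in> space \<Omega>. inj_on (\<lambda>j. H j \<omega>) {1..M}}" for d
  have inj_meas: "{\<omega> \<in> space \<Omega>. inj_on (\<lambda>j. H j \<omega>) {1..M}} \<in> sets \<Omega>"
    unfolding inj_on_def by measurable
  have E'_meas: "E' d \<in> sets \<Omega>" if "d \<in> D" for d
    unfolding E'_def using E_meas[OF that] inj_meas by (rule sets.Int)
  have disj: "disjoint_family_on E' D"
  proof (unfold disjoint_family_on_def, intro ballI impI)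
    fix d d' assume d: "d \<in> D" "d' \<in> D" "d \<noteq> d'"
    obtain i S i' S' where eq: "d = (i, S)" "d' = (i', S')"
      by (metis surj_pair)
    have False if "\<omega> \<in> E' d" "\<omega> \<in> E' d'" for \<omega>
      using that E_iff[of i S \<omega>] E_iff[of i' S' \<omega>] d unfolding eq by (simp add: E'_def)
    then show "E' d \<inter> E' d' = {}"
      by blast
  qed
  have "AE \<omega> in \<Omega>. \<forall>i\<in>{1..M}. 0 < G i \<omega>"
    using pos by (intro AE_finite_allI) auto
  \<comment> \<open>For an outcome with distinct uplink and positive downlink gains,
    \<open>snr_le_iff\<close> is applied to the selected device, and the pair made of this device
    and the set ahead of it is the only one in \<open>D\<close> whose event can contain the
    outcome.\<close>
  with inj have "AE \<omega> in \<Omega>. \<omega> \<in> space \<Omega> - out \<longleftrightarrow> \<omega> \<in> (\<Union>d\<in>D. E' d)"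
  proof eventually_elim
    case (elim \<omega>)
    show ?case
    proof (cases "\<omega> \<in> space \<Omega>")
      case True
      define i where "i = idx \<omega>"
      define S where "S = {j \<in> {1..M}. H i \<omega> < H j \<omega>}"
      have i: "i \<in> {1..M}" using idx_in by (simp add: i_def)
      have iS: "(i, S) \<in> D"
        using kth_largest_index_unique[OF elim(1) assms(13,14), of i] i
        by (auto simp: D_def S_def i_def idx_def)
      have "\<omega> \<in> (\<Union>d\<in>D. E' d) \<longleftrightarrow> r < H i \<omega> \<and> \<tau> (H i \<omega>) < G i \<omega>"
      proof
        assume "\<omega> \<in> (\<Union>d\<in>D. E' d)"
        then obtain i' S' where "(i', S') \<in> D" "\<omega> \<in> E (i', S')"
          by (auto simp: E'_def)
        then show "r < H i \<omega> \<and> \<tau> (H i \<omega>) < G i \<omega>"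
          using E_iff[of i' S' \<omega>] True elim(1) by (auto simp: i_def)
      next
        assume "r < H i \<omega> \<and> \<tau> (H i \<omega>) < G i \<omega>"
        then have "\<omega> \<in> E' (i, S)"
          using E_iff[OF iS True elim(1)] True elim(1) by (simp add: E'_def i_def S_def)
        then show "\<omega> \<in> (\<Union>d\<in>D. E' d)"
          using iS by blast
      qed
      moreover have "\<omega> \<in> out \<longleftrightarrow> \<not> (r < H i \<omega> \<and> \<tau> (H i \<omega>) < G i \<omega>)"
        using snr_le_iff[OF assms(6-8) t2 assms(11,12,15) bspec[OF elim(2) i] assms(16), of "H i \<omega>"] True
        by (simp add: out_def i_def[symmetric] \<tau>_def)
      ultimately show ?thesis
        using True by blast
    qed (use E_meas sets.sets_into_space in \<open>auto simp: E'_def\<close>)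
  qed
  then have "prob (space \<Omega> - out) = prob (\<Union>d\<in>D. E' d)"
    using out_meas E'_meas fin_D by (intro finite_measure_eq_AE) auto
  also have "\<dots> = (\<Sum>d\<in>D. prob (E' d))"
    using E'_meas fin_D disj by (intro finite_measure_finite_Union) auto

  \<comment> \<open>Summation of the equal probabilities\<close>
  also have "\<dots> = (\<Sum>d\<in>D. \<Sum>m = 0..M - k. (- 1) ^ m * real ((M - k) choose m) * ibs_Phi P\<^sub>t c k r m)"
  proof (intro sum.cong refl)
    fix d assume d: "d \<in> D"
    obtain i S where eq: "d = (i, S)" by fastforce
    \<comment> \<open>As \<open>1 \<le> k\<close>, the truncated subtraction in
      \<open>card S = k - 1\<close> is exact. The rate is therefore \<open>k\<close> and the
      exponent \<open>M - k\<close>, the same for every pair, so the sum over \<open>D\<close> is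
      multiplication by \<open>card D\<close>.\<close>
    have iS: "i \<in> {1..M}" "S \<subseteq> {1..M} - {i}" "Suc (card S) = k"
      using d assms(13) by (auto simp: D_def eq)
    \<comment> \<open>The tie set is null, so the probability may be computed for
      \<open>E d\<close>, where the rank formula applies.\<close>
    have "AE \<omega> in \<Omega>. \<omega> \<in> E' d \<longleftrightarrow> \<omega> \<in> E d"
      using inj by (auto simp: E'_def E_def)
    then have "prob (E' d) = prob (E d)"
      using E_meas[OF d] E'_meas[OF d] by (intro finite_measure_eq_AE)
    also have "\<dots> = (LBINT z:{r<..}. exp (- real k * z - \<tau> z) * (1 - exp (- z)) ^ (M - k))"
    proof -
      have "0 \<le> \<tau> z" if "r < z" for z
        using that r assms(6,11) by (simp add: \<tau>_def)
      then show ?thesis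
        using prob_rank_and_threshold[of "{1..M}" i S G H \<tau> r] iS G H indep r
        by (simp add: E_def eq)
    qed
    also have "\<dots> = (\<Sum>m = 0..M - k. (- 1) ^ m * real ((M - k) choose m) * ibs_Phi P\<^sub>t c k r m)"
      unfolding \<tau>_def using assms(6,11,13) r by (intro integral_binomial_ibs_Phi) auto
    finally show "prob (E' d) = (\<Sum>m = 0..M - k. (- 1) ^ m * real ((M - k) choose m) * ibs_Phi P\<^sub>t c k r m)" .
  qed
  also have "\<dots> = real k * real (M choose k) *
      (\<Sum>m = 0..M - k. (- 1) ^ m * real ((M - k) choose m) * ibs_Phi P\<^sub>t c k r m)"
    by (simp add: card_D)
  finally have "prob (space \<Omega> - out) = \<dots>" .
  moreover have "ibs_outage \<Omega> M G H t\<^sub>1 t\<^sub>2 P\<^sub>t \<sigma>\<^sub>n a b c k x = prob out"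
    by (simp add: ibs_outage_def out_def idx_def Let_def)
  ultimately show ?thesis
    using prob_compl[OF out_meas] by simp
qed

end
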